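(* For every integer $k\ge 0$ define $$A_{4k+1}=\{-7,0,5,8,15\}\cup\Big(\{5j+\delta: j\in\mathbb{Z},\ -k-5\le j\le k+6,\ \delta\in\{1,2\}\}\setminus\{-9,1,2,6,7,17\}\Big),$$ $$A_{4k+2}=A_{4k+1}\cup\{5k+36\},$$ $$A_{4k+3}=A_{4k+1}\cup\{-5k-28,\,5k+36\},$$ $$A_{4k+4}=A_{4k+3}\cup\{5k+37\}.$$ Then for every $k\ge0$, $$|A_{4k+1}+A_{4k+1}|=|A_{4k+1}-A_{4k+1}|+1,\qquad |A_{4k+2}-A_{4k+2}|=|A_{4k+2}+A_{4k+2}|+1,$$ $$|A_{4k+3}+A_{4k+3}|=|A_{4k+3}-A_{4k+3}|+1,\qquad |A_{4k+4}-A_{4k+4}|=|A_{4k+4}+A_{4k+4}|+1,$$ and $A_{4k+1}\subset A_{4k+2}\subset A_{4k+3}\subset A_{4k+4}\subset A_{4k+5}$. Consequently $A_1\subset A_2\subset A_3\subset\cdots$ is a non-filling-in alternating sequence.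
   Context: For a finite set of integers $A$, $A+A=\{a+b:a,b\in A\}$ and $A-A=\{a-b:a,b\in A\}$; $|\cdot|$ denotes cardinality. $A$ is MSTD (More Sums Than Differences) if $|A+A|>|A-A|$, and MDTS (More Differences Than Sums) if $|A-A|>|A+A|$. A non-filling-in alternating sequence is an infinite sequence $A_1,A_2,A_3,\dots$ of finite sets of integers such that each $A_i$ is properly contained in $A_{i+1}$, the sets are alternately MSTD and MDTS (here $A_i$ is MSTD for odd $i$ and MDTS for even $i$), and no filling in occurs: for every $j$, if an integer $z$ with $\min A_j\le z\le\max A_j$ is not in $A_j$, then $z\notin A_i$ for all $i>j$. *)

theory Defs
  imports Complex_Main "HOL-Library.Set_Algebras"
begin

text \<open>The sumset is \<open>A + A\<close> from \<open>HOL-Library.Set_Algebras\<close>; \<open>A - A\<close> on sets is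
  set-theoretic difference, so the difference set gets its own name.\<close>

definition diffset :: "int set \<Rightarrow> int set" where
  "diffset A = {a - b | a b. a \<in> A \<and> b \<in> A}"

definition MSTD :: "int set \<Rightarrow> bool" where
  "MSTD A \<longleftrightarrow> finite A \<and> card (A + A) > card (diffset A)"

definition MDTS :: "int set \<Rightarrow> bool" where
  "MDTS A \<longleftrightarrow> finite A \<and> card (diffset A) > card (A + A)"

text \<open>Sequences are indexed from 1; the value at index 0 is irrelevant. All sets involved are
  nonempty (the first one is MSTD), so \<open>Min\<close> and \<open>Max\<close> are meaningful.\<close>

definition non_filling_in_alternating :: "(nat \<Rightarrow> int set) \<Rightarrow> bool" where
  "non_filling_in_alternating A \<longleftrightarrow>
     (\<forall>i\<ge>1. finite (A i)) \<and>
     (\<forall>i\<ge>1. A i \<subset> A (i + 1)) \<and>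
     (\<forall>i\<ge>1. (odd i \<longrightarrow> MSTD (A i)) \<and> (even i \<longrightarrow> MDTS (A i))) \<and>
     (\<forall>j\<ge>1. \<forall>z. Min (A j) \<le> z \<and> z \<le> Max (A j) \<and> z \<notin> A j \<longrightarrow> (\<forall>i>j. z \<notin> A i))"

end

theory Submission
  imports Defs
begin

text \<open>
  Each set of the sequence is the part of one fixed infinite set \<open>C\<close>, namely \<open>insert 5 frame\<close>,
  that lies in an interval with endpoints in \<open>C\<close>, and the intervals grow. This alone excludes
  filling in: an integer inside the interval of \<open>A j\<close> that is not in \<open>A j\<close> is not in \<open>C\<close> at all.

  The set \<open>frame\<close> is symmetric under \<open>a \<mapsto> 8 - a\<close>. For a finite symmetric set \<open>D = c - D\<close>, the
  differences are the sums shifted by \<open>c\<close>, so both are equally many. The windows of odd index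
  are \<open>insert 5 D\<close> with \<open>D\<close> symmetric, and the extra element 5 is placed so that \<open>5 + D\<close> lies
  inside \<open>D + D\<close>. By symmetry \<open>5 - D\<close> then lies inside \<open>D - D\<close>, so there is no new difference,
  whereas \<open>10\<close> is a new sum. Hence sums win by exactly one, with no need to count either side.

  A window of even index has one more element \<open>x\<close>, larger than all the others. Let \<open>N\<close> be the
  set of those sums \<open>x + d\<close>, \<open>d \<in> D\<close>, that are not in \<open>D + D\<close>. The new sums are \<open>N\<close>
  and \<open>2x\<close>. By symmetry the new differences are \<open>N - c\<close> and its negative, so there are
  \<open>2|N|\<close> of them: differences are counted with both signs, sums only once. For both kinds of
  extension that occur, \<open>|N| = 3\<close> (lemmas \<open>new_sums_four_above\<close> and \<open>new_sums_one_above\<close>),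
  so 4 sums and 6 differences are gained, and differences win by one. The next element
  added restores the symmetry and the cycle goes on.
\<close>

section \<open>A symmetric set with one extra element\<close>

locale almost_symmetric =
  fixes D :: "int set" and c e :: int
  assumes finite: "finite D"
    and nonempty: "D \<noteq> {}"
    and reflect: "d \<in> D \<Longrightarrow> c - d \<in> D"
    and e_absorbed: "d \<in> D \<Longrightarrow> e + d \<in> D + D"
    and double_e_new: "e + e \<notin> D + D"
begin

lemma sum_reflect:
  assumes "s \<in> D + D"
  shows "2 * c - s \<in> D + D"
proof -
  from assms obtain a b where "a \<in> D" "b \<in> D" "s = a + b"
    by (auto elim: set_plus_elim)
  moreover from this have "2 * c - s = (c - a) + (c - b)" by simp
  ultimately show ?thesis
    using reflect by (metis set_plus_intro)
qed

text \<open>Symmetry turns \<open>a - b\<close> into the sum \<open>a + (c - b)\<close>, shifted by \<open>c\<close>.\<close>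

lemma diff_iff_sum:
  "t + c \<in> D + D \<longleftrightarrow> (\<exists>a\<in>D. \<exists>b\<in>D. t = a - b)"
proof
  assume "t + c \<in> D + D"
  then obtain a b where "a \<in> D" "b \<in> D" "t + c = a + b"
    by (auto elim: set_plus_elim)
  then show "\<exists>a\<in>D. \<exists>b\<in>D. t = a - b"
    using reflect[of b] by (intro bexI[of _ a] bexI[of _ "c - b"]) auto
next
  assume "\<exists>a\<in>D. \<exists>b\<in>D. t = a - b"
  then obtain a b where ab: "a \<in> D" "b \<in> D" "t = a - b" by blast
  then have "t + c = a + (c - b)" by simp
  then show "t + c \<in> D + D"
    using ab reflect[of b] by (metis set_plus_intro)
qed

text \<open>The only new sum is \<open>e + e\<close>, and there is no new difference: by reflection, the hypothesis
  that \<open>e\<close> is absorbed in sums says the same about differences.\<close>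

lemma sumset_insert: "insert e D + insert e D = insert (e + e) (D + D)"
  using e_absorbed by (auto simp: set_plus_def add.commute)

lemma mem_diffset_insert: "t \<in> diffset (insert e D) \<longleftrightarrow> t + c \<in> D + D"
proof
  assume "t \<in> diffset (insert e D)"
  then obtain a b where ab: "a \<in> insert e D" "b \<in> insert e D" "t = a - b"
    by (auto simp: diffset_def)
  consider "a \<in> D" "b \<in> D" | "a = e" "b \<in> D" | "a \<in> D" "b = e" | "a = e" "b = e"
    using ab by blast
  then show "t + c \<in> D + D"
  proof cases
    case 1
    then show ?thesis using ab diff_iff_sum by blast
  next
    case 2
    moreover have "t + c = e + (c - b)" using 2 ab by simp
    ultimately show ?thesis using e_absorbed reflect by metis
  next
    case 3
    moreover have "t + c = 2 * c - (e + (c - a))" using 3 ab by simp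
    ultimately show ?thesis using e_absorbed reflect sum_reflect by metis
  next
    case 4
    obtain d where "d \<in> D" using nonempty by blast
    then show ?thesis using 4 ab diff_iff_sum[of 0] by auto
  qed
next
  assume "t + c \<in> D + D"
  then show "t \<in> diffset (insert e D)"
    using diff_iff_sum by (auto simp: diffset_def)
qed

lemma diffset_insert: "diffset (insert e D) = (\<lambda>s. s - c) ` (D + D)"
proof (intro set_eqI)
  fix t
  have "t \<in> (\<lambda>s. s - c) ` (D + D) \<longleftrightarrow> t + c \<in> D + D"
    by (auto intro: image_eqI[of _ _ "t + c"])
  then show "t \<in> diffset (insert e D) \<longleftrightarrow> t \<in> (\<lambda>s. s - c) ` (D + D)"
    by (simp add: mem_diffset_insert)
qed

lemma finite_sumset: "finite (D + D)"
  using finite by (simp add: finite_set_plus)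

lemma card_diffset_insert: "card (diffset (insert e D)) = card (D + D)"
  unfolding diffset_insert by (rule card_image) (auto simp: inj_on_def)

lemma card_sumset_insert: "card (insert e D + insert e D) = card (D + D) + 1"
  unfolding sumset_insert using finite_sumset double_e_new by simp

definition new_sums :: "int \<Rightarrow> int set" where
  "new_sums x = (+) x ` D - (D + D)"

text \<open>The last hypothesis keeps \<open>e + e\<close>, itself a sum outside \<open>D + D\<close>, from being counted
  again among the sums \<open>x + d\<close>.\<close>

lemma card_sumset_extend:
  assumes above: "\<And>d. d \<in> insert e D \<Longrightarrow> d < x"
    and "x + e \<in> D + D" and "e + e - x \<notin> D"
  shows "card (insert x (insert e D) + insert x (insert e D)) = card (D + D) + card (new_sums x) + 2"
proof -
  have "insert x (insert e D) + insert x (insert e D)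
      = insert (x + x) (insert (e + e) ((D + D) \<union> new_sums x))" (is "?L = ?R")
  proof
    show "?L \<subseteq> ?R"
      using assms(2) sumset_insert by (auto simp: set_plus_def new_sums_def add.commute)
    show "?R \<subseteq> ?L"
      by (auto simp: set_plus_def new_sums_def)
  qed
  moreover have "x + x \<notin> insert (e + e) ((D + D) \<union> new_sums x)"
  proof -
    have "s < x + x" if "s \<in> D + D" for s
      using that above by (metis add_strict_mono insertCI set_plus_elim)
    then show ?thesis
      using above by (force simp: new_sums_def)
  qed
  moreover have "e + e \<notin> (D + D) \<union> new_sums x"
    using double_e_new assms(3) by (auto simp: new_sums_def)
  moreover have "card ((D + D) \<union> new_sums x) = card (D + D) + card (new_sums x)"
    using finite_sumset finite by (intro card_Un_disjoint) (auto simp: new_sums_def)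
  ultimately show ?thesis
    using finite_sumset finite by (simp add: new_sums_def)
qed

text \<open>The differences \<open>x - d\<close> are the sums \<open>x + (c - d)\<close> shifted by \<open>c\<close>, so the new ones among
  them are counted by \<open>new_sums x\<close>. They are positive because \<open>x\<close> exceeds every element, hence
  disjoint from their negatives, and the count doubles.\<close>

lemma card_diffset_extend:
  assumes above: "\<And>d. d \<in> insert e D \<Longrightarrow> d < x"
    and absorbed: "x - e + c \<in> D + D"
  shows "card (diffset (insert x (insert e D))) = card (D + D) + 2 * card (new_sums x)"
proof -
  let ?N = "new_sums x"
  let ?pos = "(\<lambda>s. s - c) ` ?N" and ?neg = "(\<lambda>s. c - s) ` ?N"
  have refl2: "c - s \<in> diffset (insert e D) \<longleftrightarrow> s \<in> D + D" for s
    using sum_reflect[of s] sum_reflect[of "2 * c - s"] mem_diffset_insert[of "c - s"]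
    by (auto simp: algebra_simps)
  have old: "x - e \<in> diffset (insert e D)" "e - x \<in> diffset (insert e D)"
    using absorbed mem_diffset_insert[of "x - e"] refl2[of "x - e + c"] by (auto simp: algebra_simps)
  have posD: "x - d \<in> diffset (insert e D) \<union> ?pos" if "d \<in> D" for d
  proof -
    have "x - d + c = x + (c - d)" by simp
    then have "x - d + c \<in> (D + D) \<union> ?N"
      using reflect[OF that] by (auto simp: new_sums_def)
    moreover have "x - d = (x - d + c) - c" by simp
    ultimately show ?thesis using mem_diffset_insert[of "x - d"] by blast
  qed
  have negD: "d - x \<in> diffset (insert e D) \<union> ?neg" if "d \<in> D" for d
  proof -
    have "x + (c - d) \<in> (D + D) \<union> ?N"
      using reflect[OF that] by (auto simp: new_sums_def)
    moreover have "d - x = c - (x + (c - d))" by simp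
    ultimately show ?thesis using refl2[of "x + (c - d)"] by (metis UnCI UnE imageI)
  qed
  have "diffset (insert x (insert e D)) = diffset (insert e D) \<union> (?pos \<union> ?neg)" (is "?L = ?R")
  proof
    show "?L \<subseteq> ?R"
    proof
      fix t assume "t \<in> ?L"
      then obtain a b where ab: "a \<in> insert x (insert e D)" "b \<in> insert x (insert e D)" "t = a - b"
        by (auto simp: diffset_def)
      have zero: "0 \<in> diffset (insert e D)" by (auto simp: diffset_def)
      consider "a \<in> insert e D" "b \<in> insert e D" | "a = x" "b = x" | "a = x" "b = e"
        | "a = e" "b = x" | "a = x" "b \<in> D" | "a \<in> D" "b = x"
        using ab by blast
      then show "t \<in> ?R"
      proof cases
        case 1
        then show ?thesis using ab by (auto simp: diffset_def)
      qed (use ab old zero posD negD in auto)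
    qed
    show "?R \<subseteq> ?L"
    proof -
      have "diffset (insert e D) \<subseteq> ?L" by (auto simp: diffset_def)
      moreover have "x + d - c \<in> ?L" "c - (x + d) \<in> ?L" if "d \<in> D" for d
      proof -
        have "x + d - c = x - (c - d)" "c - (x + d) = (c - d) - x" by auto
        then show "x + d - c \<in> ?L" "c - (x + d) \<in> ?L"
          using reflect[OF that] unfolding diffset_def by blast+
      qed
      ultimately show ?thesis by (auto simp: new_sums_def)
    qed
  qed
  moreover have "card (diffset (insert e D) \<union> (?pos \<union> ?neg))
      = card (diffset (insert e D)) + card (?pos \<union> ?neg)"
  proof (rule card_Un_disjoint)
    have "s - c \<notin> diffset (insert e D)" "c - s \<notin> diffset (insert e D)" if "s \<in> ?N" for s
      using that mem_diffset_insert[of "s - c"] refl2[of s] by (simp_all add: new_sums_def)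
    then show "diffset (insert e D) \<inter> (?pos \<union> ?neg) = {}" by blast
  qed (use finite finite_sumset in \<open>auto simp: diffset_insert new_sums_def\<close>)
  moreover have "card (?pos \<union> ?neg) = card ?pos + card ?neg"
  proof (rule card_Un_disjoint)
    have "s > c" if "s \<in> ?N" for s
      using that above reflect by (force simp: new_sums_def)
    then have "\<forall>t\<in>?pos. 0 < t" "\<forall>t\<in>?neg. t < 0" by auto
    then show "?pos \<inter> ?neg = {}" by (metis disjoint_iff less_asym)
  qed (use finite in \<open>auto simp: new_sums_def\<close>)
  moreover have "card ?pos = card ?N" "card ?neg = card ?N"
    by (auto intro!: card_image simp: inj_on_def)
  ultimately show ?thesis
    using card_diffset_insert by simp
qed

theorem card_diffset_eq_Suc_card_sumset:
  assumes "\<And>d. d \<in> insert e D \<Longrightarrow> d < x"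
    and "x + e \<in> D + D" and "x - e + c \<in> D + D" and "e + e - x \<notin> D"
    and "card (new_sums x) = 3"
  shows "card (diffset (insert x (insert e D)))
    = card (insert x (insert e D) + insert x (insert e D)) + 1"
  using assms card_sumset_extend[of x] card_diffset_extend[of x] by simp

end

section \<open>The symmetric windows\<close>

text \<open>Two residue classes modulo 5 that the reflection \<open>a \<mapsto> 8 - a\<close> exchanges, corrected at ten
  places near the centre 4 in a way that is again symmetric.\<close>

definition frame :: "int set" where
  "frame = {a. a \<in> {-7, 0, 8, 15} \<or> (a mod 5 = 1 \<or> a mod 5 = 2) \<and> a \<notin> {-9, 1, 2, 6, 7, 17}}"

definition core :: "int \<Rightarrow> int set" where
  "core u = frame \<inter> {8 - u..u}"

lemma mem_core: "a \<in> core u \<longleftrightarrow> 8 - u \<le> a \<and> a \<le> u \<and>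
    (a = -7 \<or> a = 0 \<or> a = 8 \<or> a = 15 \<or>
     (a mod 5 = 1 \<or> a mod 5 = 2) \<and>
       a \<noteq> -9 \<and> a \<noteq> 1 \<and> a \<noteq> 2 \<and> a \<noteq> 6 \<and> a \<noteq> 7 \<and> a \<noteq> 17)"
  unfolding core_def frame_def by auto

lemma sum_memI: "a \<in> core u \<Longrightarrow> s - a \<in> core u \<Longrightarrow> s \<in> core u + core u"
  by (metis diff_add_cancel add.commute set_plus_intro)

lemma large_mem_core:
  assumes "17 < a" "a \<le> u" "a mod 5 = 1 \<or> a mod 5 = 2"
  shows "a \<in> core u"
  using assms unfolding mem_core by auto

text \<open>Residues 1 and 2 add up to 2, 3 or 4 only. Thus a sum in class 0 or 1 involves one of
  the four exceptional elements, which leaves finitely many decompositions to exclude.\<close>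

lemma sum_residue_0_1:
  assumes "s \<in> core u + core u" "s mod 5 = 0 \<or> s mod 5 = 1"
  shows "\<exists>a\<in>{-7, 0, 8, 15}. s - a \<in> core u"
proof -
  from assms(1) obtain a b where ab: "a \<in> core u" "b \<in> core u" "s = a + b"
    by (auto elim: set_plus_elim)
  then have "a \<in> {-7, 0, 8, 15} \<or> a mod 5 = 1 \<or> a mod 5 = 2"
    "b \<in> {-7, 0, 8, 15} \<or> b mod 5 = 1 \<or> b mod 5 = 2"
    by (auto simp: mem_core)
  moreover have "\<not> ((a mod 5 = 1 \<or> a mod 5 = 2) \<and> (b mod 5 = 1 \<or> b mod 5 = 2))"
    using assms(2) ab(3) by presburger
  ultimately have "a \<in> {-7, 0, 8, 15} \<or> b \<in> {-7, 0, 8, 15}" by blast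
  moreover have "s - a = b" "s - b = a" using ab(3) by simp_all
  ultimately show ?thesis using ab(1,2) by metis
qed

lemma add5_mem_core:
  assumes "d \<in> core u" "d mod 5 = 1 \<or> d mod 5 = 2" "d \<le> u - 5" "d \<notin> {-14, -4, -3, 1, 2, 12}"
  shows "d + 5 \<in> core u"
proof -
  have "8 - u \<le> d" using assms(1) by (simp add: mem_core)
  with assms(2-) show ?thesis by (simp add: mem_core)
qed

text \<open>The bound 32 ensures that the window contains all elements that serve as summands below.
  The sums \<open>5 + d\<close> are mostly \<open>0 + (d + 5)\<close>, or \<open>15 + (d - 10)\<close> near the top; the remaining
  ones are finitely many. On the other hand 10 is in class 0, so that
  \<open>sum_residue_0_1\<close> excludes it.\<close>

lemma core_almost_symmetric:
  assumes "u \<ge> 32"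
  shows "almost_symmetric (core u) 8 5"
proof
  show "finite (core u)" by (simp add: core_def)
  have "0 \<in> core u" using assms by (simp add: mem_core)
  then show "core u \<noteq> {}" by blast
  show "8 - d \<in> core u" if "d \<in> core u" for d
  proof -
    have "(8 - d) mod 5 = 1 \<longleftrightarrow> d mod 5 = 2" "(8 - d) mod 5 = 2 \<longleftrightarrow> d mod 5 = 1"
      by presburger+
    with that show ?thesis unfolding mem_core by auto
  qed
  show "5 + d \<in> core u + core u" if d: "d \<in> core u" for d
  proof -
    have pairs: "12 \<in> core u" "16 \<in> core u" "15 \<in> core u" "21 \<in> core u" "-14 \<in> core u"
      "-24 \<in> core u" "-13 \<in> core u" "-4 \<in> core u" "-7 \<in> core u" "8 \<in> core u" "-3 \<in> core u"
      using assms by (simp_all add: mem_core)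
    have "d \<noteq> 1" "d \<noteq> 2" using d by (auto simp: mem_core)
    then consider "d \<in> {-7, 0, 8, 12, 15, -14, -4, -3}" | "u - 5 < d"
      | "d \<notin> {-7, 0, 8, 15}" "d \<notin> {-14, -4, -3, 1, 2, 12}" "d \<le> u - 5"
      unfolding insert_iff empty_iff by linarith
    then show ?thesis
    proof cases
      case 1
      then show ?thesis
        using pairs sum_memI[of 12 u "5 + d"] sum_memI[of 16 u "5 + d"] sum_memI[of 21 u "5 + d"]
          sum_memI[of 15 u "5 + d"] by auto
    next
      case 2
      have "(d - 10) mod 5 = d mod 5" by presburger
      then have "d - 10 \<in> core u"
        using d 2 assms by (intro large_mem_core) (simp_all add: mem_core)
      then show ?thesis
        using pairs sum_memI[of 15 u "5 + d"] by simp
    next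
      case 3
      moreover from this have "d mod 5 = 1 \<or> d mod 5 = 2"
        using d by (simp add: mem_core)
      ultimately have "d + 5 \<in> core u"
        using d by (intro add5_mem_core)
      then show ?thesis
        using \<open>0 \<in> core u\<close> sum_memI[of 0 u "5 + d"] by (simp add: add.commute)
    qed
  qed
  show "5 + 5 \<notin> core u + core u"
    using sum_residue_0_1[of 10 u] by (auto simp: mem_core)
qed

text \<open>A sum \<open>x + d\<close> is kept when 5, 10 or 15 is moved from \<open>x\<close> to \<open>d\<close>. This brings \<open>x\<close> back
  into the window, and since the gaps that \<open>frame\<close> has in its two residue classes are short, at
  least one of the three moves takes \<open>d\<close> to an element.\<close>

lemma shift_absorbed:
  assumes "u \<ge> 32" "u < x" "x \<le> u + 5" "x mod 5 = 1 \<or> x mod 5 = 2"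
    and d: "d \<in> core u" "d mod 5 = 1 \<or> d mod 5 = 2" "d \<le> u - 5"
  shows "x + d \<in> core u + core u"
proof -
  have "(x - 5) mod 5 = x mod 5" "(x - 10) mod 5 = x mod 5" "(x - 15) mod 5 = x mod 5"
    by presburger+
  then have "x - 5 \<in> core u" "x - 10 \<in> core u" "x - 15 \<in> core u"
    using assms(1-4) by (simp_all add: large_mem_core)
  moreover have "d + 5 \<in> core u \<or> d + 10 \<in> core u \<or> d + 15 \<in> core u"
  proof (cases "d \<in> {-14, -4, -3, 1, 2, 12}")
    case True
    moreover have "-4 \<in> core u" "11 \<in> core u" "12 \<in> core u" "22 \<in> core u"
      "1 \<notin> core u" "2 \<notin> core u"
      using assms(1) by (simp_all add: mem_core)
    ultimately show ?thesis using d(1) by auto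
  next
    case False
    then have "d + 5 \<in> core u" using d by (intro add5_mem_core)
    then show ?thesis ..
  qed
  ultimately show ?thesis
    using sum_memI[of "x - 5" u "x + d"] sum_memI[of "x - 10" u "x + d"]
      sum_memI[of "x - 15" u "x + d"] by (auto simp: add.commute)
qed

lemma sum_core_le: "s \<in> core u + core u \<Longrightarrow> s \<le> 2 * u"
  by (auto simp: mem_core elim!: set_plus_elim)

section \<open>New sums when the window is extended\<close>

lemma image_diff_eqI:
  assumes "B \<subseteq> C" "f ` B \<inter> S = {}" "\<And>d. d \<in> C \<Longrightarrow> d \<notin> B \<Longrightarrow> f d \<in> S"
  shows "f ` C - S = f ` B"
  using assms by blast

text \<open>The two elements at the top cannot be shifted upwards and give sums beyond \<open>2 * u\<close>. The sum
  with 15 is in class 1 and would need another exceptional summand.\<close>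

lemma new_sums_four_above:
  assumes "u \<ge> 32" "u mod 5 = 2"
  shows "(+) (u + 4) ` core u - (core u + core u) = (+) (u + 4) ` {15, u - 1, u}"
proof -
  have small: "u + 4 + d \<in> core u + core u" if "d \<in> {-7, 0, 8}" for d
  proof -
    have "(u - 11) mod 5 = 1" using assms(2) by presburger
    then have "-3 \<in> core u" "u \<in> core u" "15 \<in> core u" "u - 11 \<in> core u" "12 \<in> core u"
      using assms by (auto simp: mem_core)
    then show ?thesis
      using that sum_memI[of "-3" u "u + 4 + d"] sum_memI[of 15 u "u + 4 + d"]
        sum_memI[of 12 u "u + 4 + d"] by auto
  qed
  have "u + 4 + d \<in> core u + core u" if d: "d \<in> core u" "d \<notin> {15, u - 1, u}" for d
  proof (cases "d \<in> {-7, 0, 8}")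
    case False
    then have *: "d mod 5 = 1 \<or> d mod 5 = 2" "d \<le> u" using d by (auto simp: mem_core)
    then have "d \<le> u - 5" using d(2) assms(2) unfolding insert_iff empty_iff by presburger
    moreover have "(u + 4) mod 5 = 1" using assms(2) by presburger
    ultimately show ?thesis using shift_absorbed[of u "u + 4" d] assms(1) d(1) * by simp
  qed (rule small)
  moreover have "u + 4 + 15 \<notin> core u + core u"
  proof -
    have "(u + 19) mod 5 = 1" "(u + 19) mod 5 \<noteq> 0" "(u + 11) mod 5 = 3" "(u + 4) mod 5 = 1"
      using assms(2) by presburger+
    then have "u + 19 \<notin> core u + core u"
      using sum_residue_0_1[of "u + 19" u] assms by (auto simp: mem_core)
    moreover have "u + 4 + 15 = u + 19" by simp
    ultimately show ?thesis by metis
  qed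
  moreover have "u + 4 + (u - 1) \<notin> core u + core u" "u + 4 + u \<notin> core u + core u"
    using sum_core_le by fastforce+
  moreover have "(u - 1) mod 5 = 1" using assms(2) by presburger
  then have "15 \<in> core u" "u - 1 \<in> core u" "u \<in> core u"
    using assms by (auto simp: mem_core)
  ultimately show ?thesis
    by (intro image_diff_eqI) simp_all
qed

text \<open>Here only \<open>u\<close> gives a sum beyond \<open>2 * u\<close>. The sum with \<open>u - 4\<close> is \<open>2 * u - 3\<close>, which would
  require both summands to exceed \<open>u - 4\<close>, where \<open>u\<close> is the only element. The sum with 8 is in class 0 and
  would need another exceptional summand.\<close>

lemma new_sums_one_above:
  assumes "u \<ge> 32" "u mod 5 = 1"
  shows "(+) (u + 1) ` core u - (core u + core u) = (+) (u + 1) ` {8, u - 4, u}"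
proof -
  have res: "(u - 4) mod 5 = 2" "(u - 10) mod 5 = 1" "(u - 14) mod 5 = 2" "(u + 1) mod 5 = 2"
    using assms(2) by presburger+
  have small: "u + 1 + d \<in> core u + core u" if "d \<in> {-7, 0, 15}" for d
  proof -
    have "8 \<in> core u" "u - 14 \<in> core u" "11 \<in> core u" "u - 10 \<in> core u" "16 \<in> core u" "u \<in> core u"
      using assms res by (auto simp: mem_core)
    then show ?thesis
      using that sum_memI[of 8 u "u + 1 + d"] sum_memI[of 11 u "u + 1 + d"]
        sum_memI[of 16 u "u + 1 + d"] by auto
  qed
  have "u + 1 + d \<in> core u + core u" if d: "d \<in> core u" "d \<notin> {8, u - 4, u}" for d
  proof (cases "d \<in> {-7, 0, 15}")
    case False
    then have *: "d mod 5 = 1 \<or> d mod 5 = 2" "d \<le> u" using d by (auto simp: mem_core)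
    then have "d \<le> u - 5" using d(2) assms(2) unfolding insert_iff empty_iff by presburger
    then show ?thesis using shift_absorbed[of u "u + 1" d] assms(1) d(1) * res(4) by simp
  qed (rule small)
  moreover have "u + 1 + 8 \<notin> core u + core u"
  proof -
    have "(u + 9) mod 5 = 0" "(u + 9) mod 5 \<noteq> 1" "(u - 6) mod 5 = 0"
      using assms(2) by presburger+
    moreover from this have "u - 6 \<notin> core u" "u + 1 \<notin> core u" "u + 9 \<notin> core u" "u + 16 \<notin> core u"
      using assms(1) by (simp_all add: mem_core)
    ultimately have "u + 9 \<notin> core u + core u"
      using sum_residue_0_1[of "u + 9" u] by (auto simp: add.commute)
    moreover have "u + 1 + 8 = u + 9" by simp
    ultimately show ?thesis by metis
  qed
  moreover have "u + 1 + (u - 4) \<notin> core u + core u"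
  proof
    assume "u + 1 + (u - 4) \<in> core u + core u"
    then obtain a b where ab: "a \<in> core u" "b \<in> core u" "u + 1 + (u - 4) = a + b"
      by (auto elim: set_plus_elim)
    have top: "d = u" if "d \<in> core u" "u - 3 \<le> d" for d
    proof -
      have "d mod 5 = 1 \<or> d mod 5 = 2" "d \<le> u"
        using that assms(1) by (auto simp: mem_core)
      then show ?thesis using that(2) assms(2) by presburger
    qed
    have "a \<le> u" "b \<le> u" using ab by (auto simp: mem_core)
    then have "a = u" "b = u" using ab top by auto
    then show False using ab(3) by simp
  qed
  moreover have "u + 1 + u \<notin> core u + core u"
    using sum_core_le by fastforce
  moreover have "8 \<in> core u" "u - 4 \<in> core u" "u \<in> core u"
    using assms res by (auto simp: mem_core)
  ultimately show ?thesis
    by (intro image_diff_eqI) simp_all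
qed

lemma card_core:
  assumes "u \<ge> 32"
  shows "card (insert 5 (core u) + insert 5 (core u)) = card (diffset (insert 5 (core u))) + 1"
proof -
  interpret almost_symmetric "core u" 8 5 using assms by (rule core_almost_symmetric)
  show ?thesis by (simp add: card_sumset_insert card_diffset_insert)
qed

lemma card_extended_core:
  assumes "u \<ge> 32" "x = u + 4 \<and> u mod 5 = 2 \<or> x = u + 1 \<and> u mod 5 = 1"
  shows "card (diffset (insert x (insert 5 (core u))))
    = card (insert x (insert 5 (core u)) + insert x (insert 5 (core u))) + 1"
proof -
  interpret almost_symmetric "core u" 8 5 using assms(1) by (rule core_almost_symmetric)
  show ?thesis
  proof (rule card_diffset_eq_Suc_card_sumset)
    show "d < x" if "d \<in> insert 5 (core u)" for d
    proof -
      have "d \<le> u" using that assms(1) by (auto simp: core_def)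
      then show ?thesis using assms(2) by linarith
    qed
    have "(10 - x) mod 5 \<noteq> 1" "(10 - x) mod 5 \<noteq> 2" "10 - x < -9"
      using assms by presburger+
    then have "10 - x \<notin> core u"
      by (simp add: mem_core)
    then show "5 + 5 - x \<notin> core u" by simp
    show "card (new_sums x) = 3"
      using assms(2)
    proof (elim disjE conjE)
      assume "x = u + 4" "u mod 5 = 2"
      then show ?thesis
        using new_sums_four_above[of u] assms(1) by (simp add: new_sums_def)
    next
      assume "x = u + 1" "u mod 5 = 1"
      then show ?thesis
        using new_sums_one_above[of u] assms(1) by (simp add: new_sums_def)
    qed
    have summands: "12 \<in> core u" "15 \<in> core u" "8 \<in> core u" "16 \<in> core u"
      using assms(1) by (simp_all add: mem_core)
    have x: "32 < x" "x \<le> u + 4" "x mod 5 = 1 \<or> x mod 5 = 2"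
      using assms by presburger+
    from x(3) have "x + 5 \<in> core u + core u \<and> x - 5 + 8 \<in> core u + core u"
    proof
      assume "x mod 5 = 1"
      then have "(x - 10) mod 5 = 1" "(x - 9) mod 5 = 2" by presburger+
      then have "x + 5 - 15 \<in> core u" "x - 5 + 8 - 12 \<in> core u"
        using x(1,2) by (simp_all add: large_mem_core)
      then show ?thesis using summands sum_memI by blast
    next
      assume "x mod 5 = 2"
      then have "(x - 11) mod 5 = 1" "(x - 5) mod 5 = 2" by presburger+
      then have "x + 5 - 16 \<in> core u" "x - 5 + 8 - 8 \<in> core u"
        using x(1,2) by (simp_all add: large_mem_core add.commute)
      then show ?thesis using summands sum_memI by blast
    qed
    then show "x + 5 \<in> core u + core u" "x - 5 + 8 \<in> core u + core u" by blast+
  qed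
qed

section \<open>The sequence as growing windows of one set\<close>

lemma Min_Max_window:
  fixes C :: "int set"
  assumes "l \<in> C" "h \<in> C" "l \<le> h"
  shows "Min (C \<inter> {l..h}) = l" "Max (C \<inter> {l..h}) = h"
  using assms by (auto intro!: Min_eqI Max_eqI)

lemma mem_frame_far: "a < -9 \<or> 17 < a \<Longrightarrow> a \<in> frame \<longleftrightarrow> a mod 5 = 1 \<or> a mod 5 = 2"
  by (auto simp: frame_def)

lemma progression_eq_core:
  "{-7, 0, 5, 8, 15} \<union>
     ({5 * j + \<delta> | j \<delta>. - int k - 5 \<le> j \<and> j \<le> int k + 6 \<and> \<delta> \<in> {1, 2}} - {-9, 1, 2, 6, 7, 17})
   = insert 5 (core (5 * int k + 32))" (is "_ \<union> (?P - _) = _")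
proof -
  have P: "?P = {a. - 5 * int k - 24 \<le> a \<and> a \<le> 5 * int k + 32 \<and> (a mod 5 = 1 \<or> a mod 5 = 2)}"
    (is "_ = ?Q")
  proof (intro equalityI subsetI)
    fix a assume "a \<in> ?P"
    then obtain j \<delta> where "a = 5 * j + \<delta>" "- int k - 5 \<le> j" "j \<le> int k + 6" "\<delta> = 1 \<or> \<delta> = 2"
      by blast
    then show "a \<in> ?Q" by auto
  next
    fix a assume "a \<in> ?Q"
    then have a: "- 5 * int k - 24 \<le> a" "a \<le> 5 * int k + 32" "a mod 5 = 1 \<or> a mod 5 = 2"
      by simp_all
    have "a = 5 * (a div 5) + a mod 5" by simp
    moreover have "- int k - 5 \<le> a div 5" "a div 5 \<le> int k + 6" using a by presburger+
    ultimately show "a \<in> ?P" using a(3) by blast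
  qed
  have window: "8 - (5 * int k + 32) = - 5 * int k - 24" by simp
  have exceptional: "- 5 * int k - 24 \<le> a \<and> a \<le> 5 * int k + 32" if "a \<in> {-7, 0, 8, 15}" for a
    using that by auto
  show ?thesis
  proof (rule set_eqI)
    fix a
    show "a \<in> {-7, 0, 5, 8, 15} \<union> (?P - {-9, 1, 2, 6, 7, 17})
        \<longleftrightarrow> a \<in> insert 5 (core (5 * int k + 32))"
      using exceptional[of a]
      unfolding P
      unfolding core_def frame_def window Un_iff Diff_iff Int_iff insert_iff empty_iff
        mem_Collect_eq atLeastAtMost_iff
      by blast
  qed
qed

lemma core_extend:
  assumes "u \<ge> 32" "u mod 5 = 2"
  shows "core (u + 4) = core u \<union> {4 - u, u + 4}"
proof (rule set_eqI)
  fix a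
  have ends: "(u + 4) mod 5 = 1" "(4 - u) mod 5 = 2"
    using assms(2) by presburger+
  consider "8 - u \<le> a" "a \<le> u" | "a = u + 4 \<or> a = 4 - u" | "a < 4 - u \<or> u + 4 < a"
    | "4 - u < a \<and> a < 8 - u \<or> u < a \<and> a < u + 4"
    by linarith
  then show "a \<in> core (u + 4) \<longleftrightarrow> a \<in> core u \<union> {4 - u, u + 4}"
  proof cases
    case 2
    then show ?thesis
      using ends assms(1) mem_frame_far[of a] by (auto simp: core_def)
  next
    case 4
    then have "\<not> (a mod 5 = 1 \<or> a mod 5 = 2)" using assms(2) by presburger
    then have "a \<notin> frame" using 4 assms(1) mem_frame_far[of a] by auto
    then show ?thesis using 4 assms(1) by (auto simp: core_def)
  qed (use assms(1) in \<open>auto simp: core_def\<close>)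
qed

lemma Int_window_extend:
  fixes C :: "int set"
  assumes "h' \<in> C" "l \<le> h" "h < h'" "\<And>a. a \<in> C \<Longrightarrow> h < a \<Longrightarrow> a \<le> h' \<Longrightarrow> a = h'"
  shows "insert h' (C \<inter> {l..h}) = C \<inter> {l..h'}"
  using assms by force

lemma Int_window_psubset:
  fixes C :: "int set"
  assumes "l' \<le> l" "l \<le> h" "h \<le> h'" "l' \<in> C \<and> l' < l \<or> h' \<in> C \<and> h < h'"
  shows "C \<inter> {l..h} \<subset> C \<inter> {l'..h'}"
  using assms by force

theorem mainTheorem3:
  fixes A :: "nat \<Rightarrow> int set"
  assumes A1: "\<And>k. A (4 * k + 1) =
      {-7, 0, 5, 8, 15} \<union>
      ({5 * j + \<delta> | j \<delta>. - int k - 5 \<le> j \<and> j \<le> int k + 6 \<and> \<delta> \<in> {1, 2}} - {-9, 1, 2, 6, 7, 17})"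
    and A2: "\<And>k. A (4 * k + 2) = A (4 * k + 1) \<union> {5 * int k + 36}"
    and A3: "\<And>k. A (4 * k + 3) = A (4 * k + 1) \<union> {- 5 * int k - 28, 5 * int k + 36}"
    and A4: "\<And>k. A (4 * k + 4) = A (4 * k + 3) \<union> {5 * int k + 37}"
  shows "(\<forall>k.
        card (A (4 * k + 1) + A (4 * k + 1)) = card (diffset (A (4 * k + 1))) + 1 \<and>
        card (diffset (A (4 * k + 2))) = card (A (4 * k + 2) + A (4 * k + 2)) + 1 \<and>
        card (A (4 * k + 3) + A (4 * k + 3)) = card (diffset (A (4 * k + 3))) + 1 \<and>
        card (diffset (A (4 * k + 4))) = card (A (4 * k + 4) + A (4 * k + 4)) + 1 \<and>
        A (4 * k + 1) \<subset> A (4 * k + 2) \<and>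
        A (4 * k + 2) \<subset> A (4 * k + 3) \<and>
        A (4 * k + 3) \<subset> A (4 * k + 4) \<and>
        A (4 * k + 4) \<subset> A (4 * k + 5))
    \<and> non_filling_in_alternating A"
proof -
  let ?C = "insert 5 frame"
  have shape: "A (4 * k + 1) = insert 5 (core (5 * int k + 32))"
    "A (4 * k + 2) = insert (5 * int k + 36) (insert 5 (core (5 * int k + 32)))"
    "A (4 * k + 3) = insert 5 (core (5 * int k + 36))"
    "A (4 * k + 4) = insert (5 * int k + 37) (insert 5 (core (5 * int k + 36)))" for k
  proof -
    show one: "A (4 * k + 1) = insert 5 (core (5 * int k + 32))"
      using A1[of k] progression_eq_core[of k] by simp
    then show "A (4 * k + 2) = insert (5 * int k + 36) (insert 5 (core (5 * int k + 32)))"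
      using A2[of k] by simp
    have "(5 * int k + 32) mod 5 = 2" by presburger
    then have "core (5 * int k + 32 + 4)
        = core (5 * int k + 32) \<union> {4 - (5 * int k + 32), 5 * int k + 32 + 4}"
      by (intro core_extend) simp_all
    moreover have "5 * int k + 32 + 4 = 5 * int k + 36" "4 - (5 * int k + 32) = - 5 * int k - 28"
      by simp_all
    ultimately have "core (5 * int k + 36) = core (5 * int k + 32) \<union> {- 5 * int k - 28, 5 * int k + 36}"
      by (simp only:)
    then show three: "A (4 * k + 3) = insert 5 (core (5 * int k + 36))"
      using A3[of k] one by (simp add: insert_commute)
    show "A (4 * k + 4) = insert (5 * int k + 37) (insert 5 (core (5 * int k + 36)))"
      using A4[of k] three by simp
  qed
  have C_far: "a \<in> ?C \<longleftrightarrow> a mod 5 = 1 \<or> a mod 5 = 2" if "a < -9 \<or> 17 < a" for a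
    using that mem_frame_far[of a] by auto
  have ends: "- 5 * int k - 24 \<in> ?C" "- 5 * int k - 28 \<in> ?C"
    "5 * int k + 32 \<in> ?C" "5 * int k + 36 \<in> ?C" "5 * int k + 37 \<in> ?C" for k
    by (rule C_far[THEN iffD2]; presburger)+
  have window: "A (4 * k + 1) = ?C \<inter> {- 5 * int k - 24..5 * int k + 32}"
    "A (4 * k + 2) = ?C \<inter> {- 5 * int k - 24..5 * int k + 36}"
    "A (4 * k + 3) = ?C \<inter> {- 5 * int k - 28..5 * int k + 36}"
    "A (4 * k + 4) = ?C \<inter> {- 5 * int k - 28..5 * int k + 37}" for k
  proof -
    have core_window: "insert 5 (core u) = ?C \<inter> {8 - u..u}" if "u \<ge> 32" for u
      using that by (auto simp: core_def)
    have lows: "8 - (5 * int k + 32) = - 5 * int k - 24" "8 - (5 * int k + 36) = - 5 * int k - 28"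
      by simp_all
    show one: "A (4 * k + 1) = ?C \<inter> {- 5 * int k - 24..5 * int k + 32}"
      using core_window[of "5 * int k + 32"] unfolding shape lows by simp
    show three: "A (4 * k + 3) = ?C \<inter> {- 5 * int k - 28..5 * int k + 36}"
      using core_window[of "5 * int k + 36"] unfolding shape lows by simp
    have "a = 5 * int k + 36" if "a \<in> ?C" "5 * int k + 32 < a" "a \<le> 5 * int k + 36" for a
    proof -
      have "a mod 5 = 1 \<or> a mod 5 = 2" using that C_far[of a] by auto
      then show ?thesis using that(2,3) by presburger
    qed
    then have "insert (5 * int k + 36) (?C \<inter> {- 5 * int k - 24..5 * int k + 32})
        = ?C \<inter> {- 5 * int k - 24..5 * int k + 36}"
      by (intro Int_window_extend ends) auto
    then show "A (4 * k + 2) = ?C \<inter> {- 5 * int k - 24..5 * int k + 36}"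
      using shape(1,2)[of k] one by simp
    have "insert (5 * int k + 37) (?C \<inter> {- 5 * int k - 28..5 * int k + 36})
        = ?C \<inter> {- 5 * int k - 28..5 * int k + 37}"
      by (intro Int_window_extend ends) auto
    then show "A (4 * k + 4) = ?C \<inter> {- 5 * int k - 28..5 * int k + 37}"
      using shape(3,4)[of k] three by simp
  qed
  have res: "(5 * int k + 32) mod 5 = 2" "(5 * int k + 36) mod 5 = 1" for k
    by presburger+
  have counts:
    "card (A (4 * k + 1) + A (4 * k + 1)) = card (diffset (A (4 * k + 1))) + 1"
    "card (diffset (A (4 * k + 2))) = card (A (4 * k + 2) + A (4 * k + 2)) + 1"
    "card (A (4 * k + 3) + A (4 * k + 3)) = card (diffset (A (4 * k + 3))) + 1"
    "card (diffset (A (4 * k + 4))) = card (A (4 * k + 4) + A (4 * k + 4)) + 1" for k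
    unfolding shape using res[of k] by (intro card_core card_extended_core; simp)+
  have chain: "A (4 * k + 1) \<subset> A (4 * k + 2)" "A (4 * k + 2) \<subset> A (4 * k + 3)"
    "A (4 * k + 3) \<subset> A (4 * k + 4)" "A (4 * k + 4) \<subset> A (4 * k + 5)" for k
  proof -
    have "4 * Suc k + 1 = 4 * k + 5" "- 5 * int (Suc k) - 24 = - 5 * int k - 29"
      "5 * int (Suc k) + 32 = 5 * int k + 37"
      by simp_all
    then have five: "A (4 * k + 5) = ?C \<inter> {- 5 * int k - 29..5 * int k + 37}"
      "- 5 * int k - 29 \<in> ?C"
      using window(1)[of "Suc k"] ends(1)[of "Suc k"] by metis+
    show "A (4 * k + 1) \<subset> A (4 * k + 2)" "A (4 * k + 2) \<subset> A (4 * k + 3)"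
      "A (4 * k + 3) \<subset> A (4 * k + 4)" "A (4 * k + 4) \<subset> A (4 * k + 5)"
      unfolding window five using ends five(2)
      by (intro Int_window_psubset; simp)+
  qed
  have index: "\<exists>k. i = 4 * k + 1 \<or> i = 4 * k + 2 \<or> i = 4 * k + 3 \<or> i = 4 * k + 4"
    if "i \<ge> 1" for i :: nat
    using that by presburger
  have window_ex: "\<exists>l h. A i = ?C \<inter> {l..h} \<and> l \<in> ?C \<and> h \<in> ?C \<and> l \<le> h" if i: "i \<ge> 1" for i
  proof -
    obtain k where "i = 4 * k + 1 \<or> i = 4 * k + 2 \<or> i = 4 * k + 3 \<or> i = 4 * k + 4"
      using index[OF i] by blast
    moreover have "- 5 * int k - 24 \<le> 5 * int k + 32" "- 5 * int k - 24 \<le> 5 * int k + 36"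
      "- 5 * int k - 28 \<le> 5 * int k + 36" "- 5 * int k - 28 \<le> 5 * int k + 37"
      by simp_all
    ultimately show ?thesis using window[of k] ends[of k] by metis
  qed
  have "finite (A i)" if "i \<ge> 1" for i
    using window_ex[OF that] by auto
  moreover have "A i \<subset> A (i + 1)" if "i \<ge> 1" for i
  proof -
    obtain k where "i = 4 * k + 1 \<or> i = 4 * k + 2 \<or> i = 4 * k + 3 \<or> i = 4 * k + 4"
      using index[OF \<open>i \<ge> 1\<close>] by blast
    then consider "i = 4 * k + 1" "i + 1 = 4 * k + 2" | "i = 4 * k + 2" "i + 1 = 4 * k + 3"
      | "i = 4 * k + 3" "i + 1 = 4 * k + 4" | "i = 4 * k + 4" "i + 1 = 4 * k + 5"
      by linarith
    then show ?thesis using chain[of k] by cases (simp_all only:)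
  qed
  moreover have "(odd i \<longrightarrow> MSTD (A i)) \<and> (even i \<longrightarrow> MDTS (A i))" if "i \<ge> 1" for i
  proof -
    obtain k where "i = 4 * k + 1 \<or> i = 4 * k + 2 \<or> i = 4 * k + 3 \<or> i = 4 * k + 4"
      using index[OF \<open>i \<ge> 1\<close>] by blast
    then show ?thesis
      using counts[of k] \<open>\<And>i. i \<ge> 1 \<Longrightarrow> finite (A i)\<close>[OF that]
      unfolding MSTD_def MDTS_def by (elim disjE) simp_all
  qed
  moreover have "z \<notin> A i" if "j \<ge> 1" "Min (A j) \<le> z \<and> z \<le> Max (A j) \<and> z \<notin> A j" "i > j" for i j z
  proof -
    obtain l h where lh: "A j = ?C \<inter> {l..h}" "l \<in> ?C" "h \<in> ?C" "l \<le> h"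
      using window_ex[OF \<open>j \<ge> 1\<close>] by blast
    then have "z \<notin> ?C"
      using that(2) Min_Max_window[of l ?C h] by auto
    then show ?thesis
      using window_ex[of i] that by auto
  qed
  ultimately have "non_filling_in_alternating A"
    unfolding non_filling_in_alternating_def by blast
  then show ?thesis using counts chain by blast
qed

end
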